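(* Let $w=(w(n))_{n\in\mathbb{N}}$ be a nonnegative weight sequence, let $\psi(n)=n/\phi_{\gamma_{1,w}}(n)$ for every $n\in\mathbb{N}$, and let $x\in S_{m_\psi^0}$. Then $x$ is a smooth point in $m_\psi^0$ if and only if $$\operatorname{card}\left\{n\in\mathbb{N}: x^{**}(n)\psi(n)=1\right\}=1.$$
   Context: $\mathbb{N}$ is the set of positive integers and $\ell^0$ is the set of all real sequences. For $x\in\ell^0$ put $d_x(\lambda)=\operatorname{card}\{k\in\mathbb{N}:|x(k)|>\lambda\}$ for $\lambda\ge 0$, $x^*(n)=\inf\{\lambda\ge 0: d_x(\lambda)\le n-1\}$ (decreasing rearrangement) and $x^{**}(n)=\frac1n\sum_{i=1}^n x^*(i)$ for $n\in\mathbb{N}$. A nonnegative weight sequence is a sequence $w=(w(n))_{n\in\mathbb{N}}$ of nonnegative reals, with $w(n)>0$ for at least one $n$, such that $W_1(n)=n\sum_{i=n+1}^\infty \frac{w(i)}{i}<\infty$ for every $n\in\mathbb{N}$. Put $W(n)=\sum_{i=1}^n w(i)$. The sequence Lorentz space $\gamma_{1,w}$ is the Banach space of all $x\in\ell^0$ with $\|x\|_{\gamma_{1,w}}=\sum_{n=1}^\infty x^{**}(n) w(n)<\infty$; its fundamental sequence is $\phi_{\gamma_{1,w}}(n)=\|\chi_{\{i\in\mathbb{N}:i\le n\}}\|_{\gamma_{1,w}}=W(n)+W_1(n)$. The Marcinkiewicz space $m_\psi$ is the Banach space of all $y\in\ell^0$ with $\|y\|_{m_\psi}=\sup_{n\in\mathbb{N}}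 y^{**}(n)\psi(n)<\infty$, and $m_\psi^0$ is the subspace of those $y\in m_\psi$ with $\lim_{n\to\infty}y^{**}(n)\psi(n)=0$, with the norm $\|\cdot\|_{m_\psi}$. $S_X$ denotes the unit sphere of a Banach space $X$. An element $x\in X$ is a smooth point of $X$ if there exists a unique $f\in S_{X^*}$ with $f(x)=\|x\|_X$. *)

theory Defs
  imports "HOL-Analysis.Analysis"
begin

text \<open>
  The sequence spaces are indexed by the positive integers.  A sequence is represented by a
  function on \<^typ>\<open>nat\<close> that vanishes at the unused index \<open>0\<close>, so that equality of functions is
  equality of sequences and all formulas keep their usual 1-based indices.
  Rearrangements and norms take values in \<^typ>\<open>ennreal\<close>, as they may be infinite on arbitrary
  sequences (the infimum over the empty set is \<open>\<infinity>\<close>).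
\<close>

definition seqs :: "(nat \<Rightarrow> real) set" where
  "seqs = {x. x 0 = 0}"

definition distribution :: "(nat \<Rightarrow> real) \<Rightarrow> real \<Rightarrow> enat" where
  "distribution x t = (let A = {k. k \<ge> 1 \<and> \<bar>x k\<bar> > t} in if finite A then enat (card A) else \<infinity>)"

definition rearr :: "(nat \<Rightarrow> real) \<Rightarrow> nat \<Rightarrow> ennreal" where
  "rearr x n = Inf {ennreal t | t. t \<ge> 0 \<and> distribution x t \<le> enat (n - 1)}"

definition mrearr :: "(nat \<Rightarrow> real) \<Rightarrow> nat \<Rightarrow> ennreal" where
  "mrearr x n = (\<Sum>i=1..n. rearr x i) / of_nat n"

definition tail_weight :: "(nat \<Rightarrow> real) \<Rightarrow> nat \<Rightarrow> real" where
  "tail_weight w n = real n * (\<Sum>i. w (n + 1 + i) / real (n + 1 + i))"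

definition partial_weight :: "(nat \<Rightarrow> real) \<Rightarrow> nat \<Rightarrow> real" where
  "partial_weight w n = (\<Sum>i=1..n. w i)"

text \<open>
  \<open>tail_weight w\<close> is \<open>W\<^sub>1\<close>.  Its finiteness is stated as summability below, since \<^const>\<open>suminf\<close> is
  unspecified on divergent series.
\<close>

definition weight_seq :: "(nat \<Rightarrow> real) \<Rightarrow> bool" where
  "weight_seq w \<longleftrightarrow>
     (\<forall>n\<ge>1. w n \<ge> 0) \<and> (\<exists>n\<ge>1. w n > 0) \<and>
     (\<forall>n\<ge>1. summable (\<lambda>i. w (n + 1 + i) / real (n + 1 + i)))"

definition lorentz_norm :: "(nat \<Rightarrow> real) \<Rightarrow> (nat \<Rightarrow> real) \<Rightarrow> ennreal" where
  "lorentz_norm w x = (\<Sum>n. mrearr x (Suc n) * ennreal (w (Suc n)))"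

definition lorentz_fundamental :: "(nat \<Rightarrow> real) \<Rightarrow> nat \<Rightarrow> real" where
  "lorentz_fundamental w n = enn2real (lorentz_norm w (indicator {1..n}))"

definition marc_enorm :: "(nat \<Rightarrow> real) \<Rightarrow> (nat \<Rightarrow> real) \<Rightarrow> ennreal" where
  "marc_enorm \<psi> y = (SUP n\<in>{1..}. mrearr y n * ennreal (\<psi> n))"

definition marc :: "(nat \<Rightarrow> real) \<Rightarrow> (nat \<Rightarrow> real) set" where
  "marc \<psi> = {y \<in> seqs. marc_enorm \<psi> y < \<infinity>}"

definition marc_norm :: "(nat \<Rightarrow> real) \<Rightarrow> (nat \<Rightarrow> real) \<Rightarrow> real" where
  "marc_norm \<psi> y = enn2real (marc_enorm \<psi> y)"

definition marc0 :: "(nat \<Rightarrow> real) \<Rightarrow> (nat \<Rightarrow> real) set" where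
  "marc0 \<psi> = {y \<in> marc \<psi>. (\<lambda>n. mrearr y n * ennreal (\<psi> n)) \<longlonglongrightarrow> 0}"

text \<open>
  Spheres, duals and smooth points of a real sequence space \<open>V\<close>, normed by \<open>N\<close>.  Functionals are
  required to be \<^const>\<open>extensional\<close>, so that equality of HOL functions is equality on \<open>V\<close>.
\<close>

definition unit_sphere :: "'a set \<Rightarrow> ('a \<Rightarrow> real) \<Rightarrow> 'a set" where
  "unit_sphere V N = {x \<in> V. N x = 1}"

definition dual ::
    "(nat \<Rightarrow> real) set \<Rightarrow> ((nat \<Rightarrow> real) \<Rightarrow> real) \<Rightarrow> ((nat \<Rightarrow> real) \<Rightarrow> real) set" where
  "dual V N = {f \<in> extensional V.
     (\<forall>y\<in>V. \<forall>z\<in>V. f (\<lambda>k. y k + z k) = f y + f z) \<and>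
     (\<forall>c. \<forall>y\<in>V. f (\<lambda>k. c * y k) = c * f y) \<and>
     (\<exists>C. \<forall>y\<in>V. \<bar>f y\<bar> \<le> C * N y)}"

definition dual_norm ::
    "(nat \<Rightarrow> real) set \<Rightarrow> ((nat \<Rightarrow> real) \<Rightarrow> real) \<Rightarrow> ((nat \<Rightarrow> real) \<Rightarrow> real) \<Rightarrow> real" where
  "dual_norm V N f = (SUP y\<in>{y \<in> V. N y \<le> 1}. \<bar>f y\<bar>)"

definition smooth_point ::
    "(nat \<Rightarrow> real) set \<Rightarrow> ((nat \<Rightarrow> real) \<Rightarrow> real) \<Rightarrow> (nat \<Rightarrow> real) \<Rightarrow> bool" where
  "smooth_point V N x \<longleftrightarrow>
     x \<in> V \<and> (\<exists>!f. f \<in> unit_sphere (dual V N) (dual_norm V N) \<and> f x = N x)"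

text \<open>The closed form of the fundamental sequence of the Lorentz space.\<close>

lemma distribution_ind:
  assumes "t \<ge> 0"
  shows "distribution (indicator {1..n}) t = (if t < 1 then enat n else 0)"
proof -
  have "{k. k \<ge> 1 \<and> \<bar>indicator {1..n} k :: real\<bar> > t} = (if t < 1 then {1..n} else {})"
    using assms by (auto simp: indicator_def split: if_splits)
  then show ?thesis by (auto simp: distribution_def zero_enat_def)
qed

lemma rearr_ind:
  assumes "i \<ge> 1"
  shows "rearr (indicator {1..n}) i = (if i \<le> n then 1 else 0)"
proof (cases "i \<le> n")
  case True
  have "{ennreal t | t. t \<ge> 0 \<and> distribution (indicator {1..n}) t \<le> enat (i - 1)}
      = {ennreal t | t. t \<ge> 1}"
  proof -
    have "t \<ge> 0 \<and> distribution (indicator {1..n}) t \<le> enat (i - 1) \<longleftrightarrow> t \<ge> 1" for t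
      using True assms by (cases "t \<ge> 0") (auto simp: distribution_ind simp del: One_nat_def)
    then show ?thesis by simp
  qed
  moreover have "Inf {ennreal t | t. t \<ge> 1} = 1"
    by (intro cInf_eq_minimum) (auto intro!: exI[of _ 1] simp: ennreal_ge_1)
  ultimately show ?thesis using True by (simp add: rearr_def)
next
  case False
  have "0 \<in> {ennreal t | t. t \<ge> 0 \<and> distribution (indicator {1..n}) t \<le> enat (i - 1)}"
    using False by (auto intro!: exI[of _ 0] simp: distribution_ind simp del: One_nat_def)
  then have "Inf {ennreal t | t. t \<ge> 0 \<and> distribution (indicator {1..n}) t \<le> enat (i - 1)} \<le> 0"
    by (rule Inf_lower)
  then show ?thesis using False by (simp add: rearr_def)
qed

lemma mrearr_ind:
  assumes "m \<ge> 1"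
  shows "mrearr (indicator {1..n}) m = ennreal (real (min m n) / real m)"
proof -
  have "(\<Sum>i=1..m. rearr (indicator {1..n}) i) = (\<Sum>i=1..m. if i \<le> n then 1 else 0)"
    by (intro sum.cong) (auto simp: rearr_ind simp del: One_nat_def)
  also have "\<dots> = of_nat (card ({1..m} \<inter> {i. i \<le> n}))"
    by (subst sum.inter_filter[symmetric]) (auto simp: Int_def)
  also have "{1..m} \<inter> {i. i \<le> n} = {1..min m n}" by auto
  finally show ?thesis using assms
    by (simp add: mrearr_def ennreal_of_nat_eq_real_of_nat divide_ennreal)
qed

lemma lorentz_norm_indicator:
  assumes "weight_seq w" "n \<ge> 1"
  shows "lorentz_norm w (indicator {1..n}) = ennreal (partial_weight w n + tail_weight w n)"
proof -
  let ?f = "\<lambda>m. real (min (Suc m) n) / real (Suc m) * w (Suc m)"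
  have w: "w (Suc k) \<ge> 0" for k using assms(1) by (simp add: weight_seq_def)
  have nn: "?f k \<ge> 0" for k using w by simp
  have "(\<lambda>i. w (n + 1 + i) / real (n + 1 + i)) sums (\<Sum>i. w (n + 1 + i) / real (n + 1 + i))"
    using assms by (intro summable_sums) (simp add: weight_seq_def)
  then have "(\<lambda>i. real n * (w (n + 1 + i) / real (n + 1 + i))) sums tail_weight w n"
    unfolding tail_weight_def by (rule sums_mult)
  moreover have "real n * (w (n + 1 + i) / real (n + 1 + i)) = ?f (i + n)" for i
    by (simp add: add.commute)
  ultimately have "(\<lambda>i. ?f (i + n)) sums tail_weight w n" by simp
  then have "?f sums (tail_weight w n + (\<Sum>i<n. ?f i))" using sums_iff_shift[of ?f n] by blast
  moreover have "(\<Sum>i<n. ?f i) = (\<Sum>i<n. w (Suc i))"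
    by (intro sum.cong) (auto simp: min_def)
  moreover have "\<dots> = partial_weight w n"
    unfolding partial_weight_def by (rule sum.reindex_bij_witness[of _ "\<lambda>i. i - 1" Suc]) auto
  ultimately have s: "?f sums (partial_weight w n + tail_weight w n)" by (simp add: add.commute)
  have "lorentz_norm w (indicator {1..n}) = (\<Sum>m. ennreal (?f m))"
    unfolding lorentz_norm_def using w by (simp add: mrearr_ind flip: ennreal_mult del: of_nat_Suc One_nat_def times_divide_eq_left)
  also have "\<dots> = ennreal (\<Sum>m. ?f m)"
    using s nn by (intro suminf_ennreal2) (auto simp: sums_iff)
  finally show ?thesis using s by (simp add: sums_iff)
qed

lemma lorentz_fundamental_eq:
  assumes "weight_seq w" "n \<ge> 1"
  shows "lorentz_fundamental w n = partial_weight w n + tail_weight w n"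
proof -
  have "partial_weight w n + tail_weight w n \<ge> 0"
    using assms unfolding partial_weight_def tail_weight_def weight_seq_def
    by (intro add_nonneg_nonneg sum_nonneg mult_nonneg_nonneg suminf_nonneg) auto
  then show ?thesis using assms by (simp add: lorentz_fundamental_def lorentz_norm_indicator del: One_nat_def)
qed

end

theory Submission
  imports Defs
begin

text \<open>
  Write \<open>\<phi>\<close> for the fundamental sequence \<open>W + W\<^sub>1\<close> and \<open>S n\<close> for the sum of the \<open>n\<close> largest values of
  \<open>\<bar>y\<bar>\<close>.  Then \<open>y\<^sup>*\<^sup>*(n) \<psi>(n) = S n / \<phi> n\<close>, so the norm of \<open>y\<close> is the supremum over all finite nonempty
  sets \<open>A\<close> of indices and all signs \<open>s\<close> of \<open>(\<Sum>j\<in>A. s j * y j) / \<phi> (card A)\<close>.  These are functionals of norm at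
  most one (\<open>sign_functional_le\<close>), and \<open>n\<close> belongs to the set in the theorem exactly if \<open>S n = \<phi> n\<close> for
  the point \<open>x\<close>, that is, if such a functional with \<open>card A = n\<close> norms \<open>x\<close>.

  If two cardinalities occur, the two norming functionals have supports of different sizes, hence
  differ on a unit vector, and \<open>x\<close> is not smooth (\<open>smooth_point_norming_unique\<close>).  At least one
  cardinality occurs, because \<open>S n / \<phi> n\<close> tends to zero (\<open>sphere_norming_nonempty\<close>).

  If only \<open>n\<close> occurs, the essential point is that \<open>\<phi>\<close> is concave: the graph of \<open>S\<close> lies below that of \<open>\<phi>\<close> and
  touches it at \<open>n\<close>, but not at \<open>n + 1\<close>.  Hence
  \<open>x\<^sup>*(n) = S n - S (n - 1) \<ge> \<phi> n - \<phi> (n - 1) \<ge> \<phi> (n + 1) - \<phi> n > S (n + 1) - S n = x\<^sup>*(n + 1)\<close>.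
  So the set of the \<open>n\<close> largest entries is unique, \<open>x\<close> does not vanish on it, and exactly one sign
  functional \<open>f\<^sub>0\<close> norms \<open>x\<close>.  The functionals supported on other sets stay below \<open>1 - \<eta>\<close> at \<open>x\<close> for a
  common \<open>\<eta> > 0\<close>, again because \<open>S n / \<phi> n\<close> tends to zero.  Therefore \<open>f\<^sub>0\<close> computes the norm at
  \<open>x + t y\<close> for all small \<open>t\<close>, and any norming functional \<open>f\<close> satisfies \<open>t f y \<le> t f\<^sub>0 y\<close> for small \<open>t\<close> of
  both signs, so \<open>f = f\<^sub>0\<close> (\<open>smooth_point_of_norming_unique\<close>).

  Weights enter only through \<open>\<phi>\<close>, and the argument works for every concave \<open>\<phi>\<close> that is positive on the
  positive integers and has \<open>\<phi> 0 = 0\<close>.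
\<close>

section \<open>Decreasing enumerations and largest sums\<close>

text \<open>
  Convergence to zero, in the form in which it provides maximal entries: every level set of the
  distribution function at a positive height is finite.
\<close>

definition vanishing :: "(nat \<Rightarrow> real) \<Rightarrow> bool" where
  "vanishing y \<longleftrightarrow> (\<forall>e>0. finite {k. k \<ge> 1 \<and> \<bar>y k\<bar> > e})"

text \<open>
  The values \<open>\<bar>y (k 0)\<bar>, \<bar>y (k 1)\<bar>, \<dots>\<close> are the decreasing rearrangement.  The enumeration \<open>k\<close> starts at
  index \<open>0\<close>, so \<open>k i\<close> is the position of the value \<open>y\<^sup>*(i + 1)\<close>.  It need not exhaust the positive integers:
  when infinitely many entries are nonzero, zeros are never reached.
\<close>

definition decr_enum :: "(nat \<Rightarrow> real) \<Rightarrow> (nat \<Rightarrow> nat) \<Rightarrow> bool" where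
  "decr_enum y k \<longleftrightarrow> inj k \<and> range k \<subseteq> {1..} \<and>
     (\<forall>i. \<forall>j\<ge>1. j \<notin> k ` {..<i} \<longrightarrow> \<bar>y j\<bar> \<le> \<bar>y (k i)\<bar>)"

text \<open>
  For a vanishing sequence this is the largest sum of \<open>n\<close> absolute values, see \<open>sum_le_top_sum\<close> and
  \<open>top_sum_attained\<close>.  Defining it through \<^const>\<open>mrearr\<close> makes it independent of the enumeration.
\<close>

definition top_sum :: "(nat \<Rightarrow> real) \<Rightarrow> nat \<Rightarrow> real" where
  "top_sum y n = real n * enn2real (mrearr y n)"

lemma vanishing_max_outside:
  assumes "vanishing y" "finite A"
  shows "\<exists>m\<ge>1. m \<notin> A \<and> (\<forall>j\<ge>1. j \<notin> A \<longrightarrow> \<bar>y j\<bar> \<le> \<bar>y m\<bar>)"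
proof (cases "\<exists>j\<ge>1. j \<notin> A \<and> y j \<noteq> 0")
  case True
  then obtain j0 where j0: "j0 \<ge> 1" "j0 \<notin> A" "y j0 \<noteq> 0" by blast
  define L where "L = {k. k \<ge> 1 \<and> \<bar>y k\<bar> > \<bar>y j0\<bar> / 2} - A"
  have "\<bar>y j0\<bar> / 2 > 0" using j0 by simp
  then have "finite L" using assms(1) unfolding L_def vanishing_def by blast
  have "j0 \<in> L" using j0 by (simp add: L_def)
  then have "Max ((\<lambda>j. \<bar>y j\<bar>) ` L) \<in> (\<lambda>j. \<bar>y j\<bar>) ` L" using \<open>finite L\<close> by (intro Max_in) auto
  then obtain m where "m \<in> L" and eq: "Max ((\<lambda>j. \<bar>y j\<bar>) ` L) = \<bar>y m\<bar>" by blast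
  then have m: "m \<in> L" "\<And>j. j \<in> L \<Longrightarrow> \<bar>y j\<bar> \<le> \<bar>y m\<bar>"
    using \<open>finite L\<close> unfolding eq[symmetric] by simp_all
  have "\<bar>y j\<bar> \<le> \<bar>y m\<bar>" if "j \<ge> 1" "j \<notin> A" for j
    using m(2)[of j] m(2)[OF \<open>j0 \<in> L\<close>] that by (cases "j \<in> L") (auto simp: L_def)
  then show ?thesis using m(1) by (auto simp: L_def)
next
  case False
  obtain m where "m \<notin> insert 0 A" using ex_new_if_finite[of "insert 0 A"] assms(2) by auto
  then show ?thesis using False by (intro exI[of _ m]) auto
qed

text \<open>The enumeration is built greedily: each step picks a largest entry outside those picked before.\<close>

lemma vanishing_decr_enum:
  assumes "vanishing y"
  obtains k where "decr_enum y k"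
proof -
  obtain p where p: "\<And>A. finite A \<Longrightarrow> p A \<ge> 1 \<and> p A \<notin> A \<and> (\<forall>j\<ge>1. j \<notin> A \<longrightarrow> \<bar>y j\<bar> \<le> \<bar>y (p A)\<bar>)"
    using vanishing_max_outside[OF assms] by metis
  define A where "A = rec_nat {} (\<lambda>_ B. insert (p B) B)"
  define k where "k n = p (A n)" for n
  have A: "A n = k ` {..<n}" for n
    by (induction n) (simp_all add: A_def k_def lessThan_Suc)
  have k: "k n \<ge> 1 \<and> k n \<notin> k ` {..<n} \<and> (\<forall>j\<ge>1. j \<notin> k ` {..<n} \<longrightarrow> \<bar>y j\<bar> \<le> \<bar>y (k n)\<bar>)" for n
    using p[of "A n"] by (simp add: A k_def[of n])
  have "inj k"
  proof (rule linorder_injI)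
    fix i j :: nat assume "i < j"
    then show "k i \<noteq> k j" using k[of j] by (metis imageI lessThan_iff)
  qed
  with k have "decr_enum y k" by (auto simp: decr_enum_def)
  then show ?thesis by (rule that)
qed

lemma decr_enum_antimono:
  assumes "decr_enum y k" "i \<le> j"
  shows "\<bar>y (k j)\<bar> \<le> \<bar>y (k i)\<bar>"
proof -
  have "k j \<notin> k ` {..<i}" using assms by (auto simp: decr_enum_def inj_eq)
  then show ?thesis using assms(1) by (auto simp: decr_enum_def)
qed

lemma rearr_decr_enum:
  assumes k: "decr_enum y k"
  shows "rearr y (Suc i) = ennreal \<bar>y (k i)\<bar>"
proof -
  have iff: "distribution y t \<le> enat i \<longleftrightarrow> \<bar>y (k i)\<bar> \<le> t" for t
  proof
    assume d: "distribution y t \<le> enat i"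
    then have fin: "finite {j. j \<ge> 1 \<and> \<bar>y j\<bar> > t}" and c: "card {j. j \<ge> 1 \<and> \<bar>y j\<bar> > t} \<le> i"
      by (auto simp: distribution_def Let_def split: if_splits)
    show "\<bar>y (k i)\<bar> \<le> t"
    proof (rule ccontr)
      assume "\<not> ?thesis"
      then have "k ` {..i} \<subseteq> {j. j \<ge> 1 \<and> \<bar>y j\<bar> > t}"
        using k decr_enum_antimono[OF k, of _ i] by (fastforce simp: decr_enum_def)
      from card_mono[OF fin this] have "card (k ` {..i}) \<le> i" using c by simp
      moreover have "card (k ` {..i}) = Suc i"
        using k by (subst card_image) (auto simp: decr_enum_def inj_on_def)
      ultimately show False by simp
    qed
  next
    assume le: "\<bar>y (k i)\<bar> \<le> t"
    have sub: "{j. j \<ge> 1 \<and> \<bar>y j\<bar> > t} \<subseteq> k ` {..<i}"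
    proof
      fix j assume j: "j \<in> {j. j \<ge> 1 \<and> \<bar>y j\<bar> > t}"
      show "j \<in> k ` {..<i}"
      proof (rule ccontr)
        assume "j \<notin> k ` {..<i}"
        then have "\<bar>y j\<bar> \<le> \<bar>y (k i)\<bar>" using k j by (simp add: decr_enum_def)
        then show False using j le by simp
      qed
    qed
    have "card {j. j \<ge> 1 \<and> \<bar>y j\<bar> > t} \<le> card (k ` {..<i})" by (rule card_mono[OF _ sub]) simp
    also have "\<dots> \<le> i" using card_image_le[of "{..<i}" k] by simp
    finally show "distribution y t \<le> enat i"
      using finite_subset[OF sub] by (simp add: distribution_def)
  qed
  show ?thesis unfolding rearr_def
    by (intro cInf_eq_minimum) (auto simp: iff intro!: ennreal_leI exI[of _ "\<bar>y (k i)\<bar>"])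
qed

lemma top_sum_decr_enum:
  assumes "decr_enum y k"
  shows "top_sum y n = (\<Sum>i<n. \<bar>y (k i)\<bar>)"
    and "n \<ge> 1 \<Longrightarrow> mrearr y n = ennreal (top_sum y n / real n)"
proof -
  have *: "mrearr y n = ennreal ((\<Sum>i<n. \<bar>y (k i)\<bar>) / real n)" if "n \<ge> 1" for n
  proof -
    have "(\<Sum>i=1..n. rearr y i) = (\<Sum>i<n. rearr y (Suc i))"
      by (rule sum.reindex_bij_witness[of _ Suc "\<lambda>i. i - 1"]) auto
    also have "\<dots> = ennreal (\<Sum>i<n. \<bar>y (k i)\<bar>)"
      by (simp add: rearr_decr_enum[OF assms] sum_ennreal)
    finally show ?thesis using that
      by (simp add: mrearr_def ennreal_of_nat_eq_real_of_nat divide_ennreal sum_nonneg)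
  qed
  show 1: "top_sum y n = (\<Sum>i<n. \<bar>y (k i)\<bar>)" for n
    by (cases n) (simp_all add: * top_sum_def sum_nonneg)
  show "n \<ge> 1 \<Longrightarrow> mrearr y n = ennreal (top_sum y n / real n)" by (simp add: * 1)
qed

lemma top_sum_nonneg: "top_sum y n \<ge> 0"
  by (simp add: top_sum_def)

lemma top_sum_Suc:
  assumes "decr_enum y k"
  shows "top_sum y (Suc n) = top_sum y n + \<bar>y (k n)\<bar>"
  by (simp add: top_sum_decr_enum[OF assms])

lemma sum_decr_enum_image:
  assumes "decr_enum y k"
  shows "(\<Sum>j\<in>k ` {..<n}. \<bar>y j\<bar>) = top_sum y n" "card (k ` {..<n}) = n"
proof -
  have "inj_on k {..<n}" using assms by (auto simp: decr_enum_def intro: inj_on_subset)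
  then show "(\<Sum>j\<in>k ` {..<n}. \<bar>y j\<bar>) = top_sum y n" "card (k ` {..<n}) = n"
    by (simp_all add: top_sum_decr_enum(1)[OF assms] sum.reindex card_image)
qed

text \<open>
  Exchange argument: passing from the top set to \<open>B\<close> replaces equally many entries of size at least
  \<open>\<bar>y (k n)\<bar>\<close> by entries of size at most \<open>\<bar>y (k (Suc n))\<bar>\<close>, and at least one exchange takes place.  A strict
  drop after position \<open>n\<close> thus separates the top set from all other sets of its size.
\<close>

lemma sum_le_top_sum_gap:
  assumes k: "decr_enum y k" and B: "B \<subseteq> {1..}" "finite B" "card B = Suc n"
    and ne: "B \<noteq> k ` {..<Suc n}"
  shows "(\<Sum>j\<in>B. \<bar>y j\<bar>) \<le> top_sum y (Suc n) - (\<bar>y (k n)\<bar> - \<bar>y (k (Suc n))\<bar>)"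
proof -
  define A where "A = k ` {..<Suc n}"
  define c where "c = card (B - A)"
  have finA: "finite A" and cA: "card A = Suc n"
    using sum_decr_enum_image(2)[OF k] by (simp_all add: A_def)
  have c': "card (A - B) = c"
    using card_Diff_subset_Int[of A B] card_Diff_subset_Int[of B A] B cA finA
    by (simp add: c_def Int_commute)
  have "c \<noteq> 0"
  proof
    assume "c = 0"
    then have "B \<subseteq> A" using B by (simp add: c_def)
    then have "B = A" using card_subset_eq[of A B] finA B cA by simp
    then show False using ne by (simp add: A_def)
  qed
  have 1: "(\<Sum>j\<in>B - A. \<bar>y j\<bar>) \<le> real c * \<bar>y (k (Suc n))\<bar>"
    unfolding c_def using k B(1) by (intro sum_bounded_above) (auto simp: A_def decr_enum_def)
  have 2: "real c * \<bar>y (k n)\<bar> \<le> (\<Sum>j\<in>A - B. \<bar>y j\<bar>)"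
    unfolding c'[symmetric]
    by (intro sum_bounded_below) (auto simp: A_def less_Suc_eq_le intro!: decr_enum_antimono[OF k])
  have "1 * (\<bar>y (k n)\<bar> - \<bar>y (k (Suc n))\<bar>) \<le> real c * (\<bar>y (k n)\<bar> - \<bar>y (k (Suc n))\<bar>)"
    using \<open>c \<noteq> 0\<close> decr_enum_antimono[OF k, of n "Suc n"] by (intro mult_right_mono) auto
  with 1 2 have 3: "(\<Sum>j\<in>B - A. \<bar>y j\<bar>) + (\<bar>y (k n)\<bar> - \<bar>y (k (Suc n))\<bar>) \<le> (\<Sum>j\<in>A - B. \<bar>y j\<bar>)"
    by (simp add: algebra_simps)
  have "(\<Sum>j\<in>A. \<bar>y j\<bar>) = (\<Sum>j\<in>A \<inter> B. \<bar>y j\<bar>) + (\<Sum>j\<in>A - B. \<bar>y j\<bar>)"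
    using finA by (metis sum.Int_Diff)
  moreover have "(\<Sum>j\<in>B. \<bar>y j\<bar>) = (\<Sum>j\<in>A \<inter> B. \<bar>y j\<bar>) + (\<Sum>j\<in>B - A. \<bar>y j\<bar>)"
    using B by (metis sum.Int_Diff Int_commute)
  moreover have "(\<Sum>j\<in>A. \<bar>y j\<bar>) = top_sum y (Suc n)"
    unfolding A_def by (rule sum_decr_enum_image(1)[OF k])
  ultimately show ?thesis using 3 by simp
qed

lemma sum_le_top_sum:
  assumes "vanishing y" "B \<subseteq> {1..}" "finite B"
  shows "(\<Sum>j\<in>B. \<bar>y j\<bar>) \<le> top_sum y (card B)"
proof (cases "card B")
  case 0
  then show ?thesis using assms by (simp add: top_sum_def)
next
  case (Suc n)
  obtain k where k: "decr_enum y k" using vanishing_decr_enum[OF assms(1)] .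
  show ?thesis
  proof (cases "B = k ` {..<Suc n}")
    case True
    then show ?thesis using sum_decr_enum_image(1)[OF k, of "Suc n"] Suc by simp
  next
    case False
    then show ?thesis
      using sum_le_top_sum_gap[OF k assms(2,3) Suc False] Suc decr_enum_antimono[OF k, of n "Suc n"]
      by simp
  qed
qed

lemma top_sum_attained:
  assumes "vanishing y"
  obtains B where "B \<subseteq> {1..}" "finite B" "card B = n" "top_sum y n = (\<Sum>j\<in>B. \<bar>y j\<bar>)"
proof -
  obtain k where k: "decr_enum y k" using vanishing_decr_enum[OF assms] .
  then have "k ` {..<n} \<subseteq> {1..}" by (auto simp: decr_enum_def)
  then show ?thesis using sum_decr_enum_image[OF k] by (intro that[of "k ` {..<n}"]) auto
qed

lemma vanishing_add:
  assumes "vanishing y" "vanishing z"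
  shows "vanishing (\<lambda>j. y j + z j)"
  unfolding vanishing_def
proof (intro allI impI)
  fix e :: real assume "e > 0"
  then have "e / 2 > 0" by simp
  then have "finite ({j. j \<ge> 1 \<and> \<bar>y j\<bar> > e/2} \<union> {j. j \<ge> 1 \<and> \<bar>z j\<bar> > e/2})"
    using assms unfolding vanishing_def by blast
  then show "finite {j. j \<ge> 1 \<and> \<bar>y j + z j\<bar> > e}"
    by (rule finite_subset[rotated]) auto
qed

lemma vanishing_cmult:
  assumes "vanishing y"
  shows "vanishing (\<lambda>j. c * y j)"
proof (cases "c = 0")
  case False
  then have "{j. j \<ge> 1 \<and> \<bar>c * y j\<bar> > e} = {j. j \<ge> 1 \<and> \<bar>y j\<bar> > e / \<bar>c\<bar>}" for e
    by (auto simp: abs_mult field_simps)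
  then show ?thesis using assms False by (simp add: vanishing_def)
qed (simp add: vanishing_def)

lemma top_sum_add:
  assumes "vanishing y" "vanishing z"
  shows "top_sum (\<lambda>j. y j + z j) n \<le> top_sum y n + top_sum z n"
proof -
  obtain B where B: "B \<subseteq> {1..}" "finite B" "card B = n"
      "top_sum (\<lambda>j. y j + z j) n = (\<Sum>j\<in>B. \<bar>y j + z j\<bar>)"
    using top_sum_attained[OF vanishing_add[OF assms]] .
  have "(\<Sum>j\<in>B. \<bar>y j + z j\<bar>) \<le> (\<Sum>j\<in>B. \<bar>y j\<bar>) + (\<Sum>j\<in>B. \<bar>z j\<bar>)"
    by (simp add: sum_mono flip: sum.distrib)
  then show ?thesis using B sum_le_top_sum[of y B] sum_le_top_sum[of z B] assms by simp
qed

lemma top_sum_cmult_le: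
  assumes "vanishing y"
  shows "top_sum (\<lambda>j. c * y j) n \<le> \<bar>c\<bar> * top_sum y n"
proof -
  obtain B where B: "B \<subseteq> {1..}" "finite B" "card B = n"
      "top_sum (\<lambda>j. c * y j) n = (\<Sum>j\<in>B. \<bar>c * y j\<bar>)"
    using top_sum_attained[OF vanishing_cmult[OF assms]] .
  have "(\<Sum>j\<in>B. \<bar>c * y j\<bar>) = \<bar>c\<bar> * (\<Sum>j\<in>B. \<bar>y j\<bar>)" by (simp add: abs_mult sum_distrib_left)
  also have "\<dots> \<le> \<bar>c\<bar> * top_sum y n"
    using sum_le_top_sum[OF assms B(1,2)] B(3) by (intro mult_left_mono) auto
  finally show ?thesis using B(4) by simp
qed

lemma abs_add_eq_sgn_mult:
  fixes a u :: real
  assumes "\<bar>u\<bar> < \<bar>a\<bar>"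
  shows "\<bar>a + u\<bar> = sgn a * (a + u)"
proof (cases "a > 0")
  case True
  then have "a + u > 0" using assms by linarith
  then show ?thesis using True by simp
next
  case False
  then have "a < 0" "a + u < 0" using assms by linarith+
  then show ?thesis by simp
qed

text \<open>
  An infinite level set keeps all rearranged values above its height; this is how a vanishing mean
  rearrangement forces the sequence itself to vanish.
\<close>

lemma infinite_level_le_mrearr:
  assumes "e > 0" "infinite {k. k \<ge> 1 \<and> \<bar>y k\<bar> > e}" "n \<ge> 1"
  shows "ennreal e \<le> mrearr y n"
proof -
  have "ennreal e \<le> rearr y i" for i
    unfolding rearr_def
  proof (rule Inf_greatest, safe)
    fix t :: real assume t: "distribution y t \<le> enat (i - 1)"
    have "e \<le> t"
    proof (rule ccontr)
      assume "\<not> e \<le> t"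
      then have "infinite {k. k \<ge> 1 \<and> \<bar>y k\<bar> > t}"
        using assms(2) by (auto elim!: infinite_super[rotated])
      then show False using t by (simp add: distribution_def)
    qed
    then show "ennreal e \<le> ennreal t" by (rule ennreal_leI)
  qed
  then have "(\<Sum>i=1..n. ennreal e) \<le> (\<Sum>i=1..n. rearr y i)" by (intro sum_mono)
  then have "(\<Sum>i=1..n. ennreal e) / of_nat n \<le> mrearr y n"
    unfolding mrearr_def by (rule divide_right_mono_ennreal)
  moreover have "(\<Sum>i=1..n. ennreal e) / of_nat n = ennreal e"
    using assms by (simp add: ennreal_of_nat_eq_real_of_nat divide_ennreal flip: ennreal_mult)
  ultimately show ?thesis by simp
qed

text \<open>
  The index set may be infinite: all but finitely many terms are below \<open>1/2\<close>, and the remaining ones have a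
  maximum.  It turns the strict inequalities \<open>S n < \<phi> n\<close> into a uniform gap.
\<close>

lemma uniform_bound_of_tendsto_0:
  fixes a :: "nat \<Rightarrow> real"
  assumes "a \<longlonglongrightarrow> 0" "\<And>m. m \<in> I \<Longrightarrow> a m < 1"
  shows "\<exists>c<1. \<forall>m\<in>I. a m \<le> c"
proof -
  obtain N where N: "\<And>m. m \<ge> N \<Longrightarrow> a m < 1/2"
    using order_tendstoD(2)[OF assms(1), of "1/2"] by (auto simp: eventually_sequentially)
  define J where "J = insert (1/2) (a ` (I \<inter> {..<N}))"
  have J: "finite J" "J \<noteq> {}" by (simp_all add: J_def)
  show ?thesis
  proof (intro exI[of _ "Max J"] conjI ballI)
    have half: "1/2 \<le> Max J" using J by (intro Max_ge) (simp_all add: J_def)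
    show "Max J < 1" using J assms(2) by (subst Max_less_iff) (auto simp: J_def)
    fix m assume m: "m \<in> I"
    show "a m \<le> Max J"
    proof (cases "m < N")
      case True
      then show ?thesis using m J by (intro Max_ge) (auto simp: J_def)
    next
      case False
      then show ?thesis using N[of m] half by simp
    qed
  qed
qed

section \<open>Marcinkiewicz spaces of concave sequences\<close>

text \<open>
  The whole argument takes place over an arbitrary concave \<open>\<phi>\<close> starting at zero; concavity across \<open>0\<close> is
  what covers the case of norming cardinality one.
\<close>

locale concave_fundamental =
  fixes \<phi> \<psi> :: "nat \<Rightarrow> real"
  assumes phi_0: "\<phi> 0 = 0"
    and phi_pos: "n \<ge> 1 \<Longrightarrow> \<phi> n > 0"
    and phi_concave: "\<phi> (Suc (Suc n)) - \<phi> (Suc n) \<le> \<phi> (Suc n) - \<phi> n"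
    and psi_eq: "n \<ge> 1 \<Longrightarrow> \<psi> n = real n / \<phi> n"
begin

abbreviation V where "V \<equiv> marc0 \<psi>"
abbreviation N where "N \<equiv> marc_norm \<psi>"

lemma phi_le: "\<phi> n \<le> real n * \<phi> 1"
proof -
  have inc: "\<phi> (Suc n) - \<phi> n \<le> \<phi> 1" for n
  proof (induction n)
    case (Suc n)
    then show ?case using phi_concave[of n] by linarith
  qed (simp add: phi_0)
  show ?thesis
  proof (induction n)
    case (Suc n)
    then show ?case using inc[of n] by (simp add: algebra_simps)
  qed (simp add: phi_0)
qed

lemma psi_ge:
  assumes "n \<ge> 1"
  shows "\<psi> n \<ge> 1 / \<phi> 1"
proof -
  have "\<phi> n / \<phi> 1 \<le> real n" using phi_le[of n] phi_pos[of 1] by (simp add: pos_divide_le_eq)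
  then show ?thesis using phi_pos[OF assms] assms by (simp add: psi_eq pos_le_divide_eq)
qed

text \<open>
  Concavity bounds \<open>\<psi>\<close> away from zero, so the defining limit of the subspace forces \<open>y\<^sup>*\<^sup>*(n)\<close>
  itself to tend to zero.
\<close>

lemma vanishing_marc0:
  assumes "y \<in> V"
  shows "vanishing y"
  unfolding vanishing_def
proof (intro allI impI, rule ccontr)
  fix e :: real assume e: "e > 0" and inf: "infinite {k. k \<ge> 1 \<and> \<bar>y k\<bar> > e}"
  have lim: "(\<lambda>n. mrearr y n * ennreal (\<psi> n)) \<longlonglongrightarrow> 0" using assms by (simp add: marc0_def)
  have "ennreal (e * (1 / \<phi> 1)) \<le> mrearr y n * ennreal (\<psi> n)" if "n \<ge> 1" for n
    using e psi_ge[OF that] phi_pos[of 1] infinite_level_le_mrearr[OF e inf that]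
    by (subst ennreal_mult) (auto intro!: mult_mono ennreal_leI)
  then have "ennreal (e * (1 / \<phi> 1)) \<le> 0"
    by (intro tendsto_lowerbound[OF lim]) (auto simp: eventually_sequentially)
  then show False using e phi_pos[of 1] by (simp add: ennreal_eq_0_iff divide_le_0_iff)
qed

lemma mrearr_psi:
  assumes "vanishing y" "n \<ge> 1"
  shows "mrearr y n * ennreal (\<psi> n) = ennreal (top_sum y n / \<phi> n)"
proof -
  obtain k where k: "decr_enum y k" using vanishing_decr_enum[OF assms(1)] .
  show ?thesis using assms(2) phi_pos[of n] top_sum_nonneg[of y n]
    by (simp add: top_sum_decr_enum(2)[OF k] psi_eq flip: ennreal_mult)
qed

text \<open>
  Membership in terms of real sums.  Finiteness of the norm follows from the limit,
  since convergent sequences are bounded.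
\<close>

lemma marc0_iff:
  "y \<in> V \<longleftrightarrow> y 0 = 0 \<and> vanishing y \<and> (\<lambda>n. top_sum y n / \<phi> n) \<longlonglongrightarrow> 0"
proof -
  have nn: "top_sum y n / \<phi> n \<ge> 0" for n
    by (cases n) (use phi_0 phi_pos[of n] top_sum_nonneg[of y n] in auto)
  have lim: "(\<lambda>n. mrearr y n * ennreal (\<psi> n)) \<longlonglongrightarrow> 0 \<longleftrightarrow> (\<lambda>n. top_sum y n / \<phi> n) \<longlonglongrightarrow> 0"
    if "vanishing y"
  proof -
    have "(\<lambda>n. mrearr y n * ennreal (\<psi> n)) \<longlonglongrightarrow> 0 \<longleftrightarrow> (\<lambda>n. ennreal (top_sum y n / \<phi> n)) \<longlonglongrightarrow> ennreal 0"
      unfolding ennreal_0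
      by (intro tendsto_cong) (auto simp: eventually_sequentially mrearr_psi[OF that] intro!: exI[of _ 1])
    also have "\<dots> \<longleftrightarrow> (\<lambda>n. top_sum y n / \<phi> n) \<longlonglongrightarrow> 0"
      using nn by (intro tendsto_ennreal_iff) auto
    finally show ?thesis .
  qed
  have "marc_enorm \<psi> y < \<infinity>" if v: "vanishing y" and l: "(\<lambda>n. top_sum y n / \<phi> n) \<longlonglongrightarrow> 0"
  proof -
    obtain K where K: "\<And>n. norm (top_sum y n / \<phi> n) \<le> K"
      using convergent_imp_Bseq[OF convergentI[OF l]] by (auto simp: Bseq_def)
    have "marc_enorm \<psi> y \<le> ennreal K"
      unfolding marc_enorm_def
    proof (rule SUP_least)
      fix n :: nat assume "n \<in> {1..}"
      then show "mrearr y n * ennreal (\<psi> n) \<le> ennreal K"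
        using abs_le_D1[OF K[of n, unfolded real_norm_def]] by (simp add: mrearr_psi[OF v] ennreal_leI)
    qed
    then show ?thesis using order_le_less_trans by fastforce
  qed
  moreover have "y \<in> V \<longleftrightarrow> y 0 = 0 \<and> marc_enorm \<psi> y < \<infinity> \<and> (\<lambda>n. mrearr y n * ennreal (\<psi> n)) \<longlonglongrightarrow> 0"
    unfolding marc0_def marc_def seqs_def by blast
  ultimately show ?thesis using vanishing_marc0[of y] lim by blast
qed

lemma norm_nonneg: "N y \<ge> 0"
  by (simp add: marc_norm_def)

lemma top_sum_le_norm:
  assumes "y \<in> V"
  shows "top_sum y n \<le> \<phi> n * N y"
proof (cases "n \<ge> 1")
  case True
  have "ennreal (top_sum y n / \<phi> n) \<le> marc_enorm \<psi> y"
    unfolding marc_enorm_def using True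
    by (auto simp: mrearr_psi[OF vanishing_marc0[OF assms]] intro!: SUP_upper2[of n])
  moreover have "marc_enorm \<psi> y = ennreal (N y)"
    using assms by (simp add: marc_norm_def marc0_def marc_def)
  ultimately have "top_sum y n / \<phi> n \<le> N y"
    by (simp add: ennreal_le_iff norm_nonneg)
  then show ?thesis using phi_pos[OF True] by (simp add: field_simps)
next
  case False
  then show ?thesis by (simp add: top_sum_def phi_0 not_le)
qed

lemma norm_le:
  assumes "y \<in> V" "\<And>n. n \<ge> 1 \<Longrightarrow> top_sum y n \<le> \<phi> n * c"
  shows "N y \<le> c"
proof -
  have "0 \<le> \<phi> 1 * c" using assms(2)[of 1] top_sum_nonneg[of y 1] by simp
  then have c: "c \<ge> 0" using phi_pos[of 1] by (simp add: zero_le_mult_iff)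
  have "marc_enorm \<psi> y \<le> ennreal c"
    unfolding marc_enorm_def
  proof (rule SUP_least)
    fix n :: nat assume n: "n \<in> {1..}"
    then show "mrearr y n * ennreal (\<psi> n) \<le> ennreal c"
      using assms(2)[of n] phi_pos[of n]
      by (auto simp: mrearr_psi[OF vanishing_marc0[OF assms(1)]] field_simps intro!: ennreal_leI)
  qed
  then show ?thesis unfolding marc_norm_def using c enn2real_leI by blast
qed

lemma marc0_add:
  assumes "y \<in> V" "z \<in> V"
  shows "(\<lambda>j. y j + z j) \<in> V"
proof -
  have v: "vanishing y" "vanishing z" using assms vanishing_marc0 by auto
  have l: "(\<lambda>n. top_sum y n / \<phi> n + top_sum z n / \<phi> n) \<longlonglongrightarrow> 0 + 0"
    using assms by (intro tendsto_add) (auto simp: marc0_iff)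
  have "(\<lambda>n. top_sum (\<lambda>j. y j + z j) n / \<phi> n) \<longlonglongrightarrow> 0"
  proof (rule tendsto_sandwich[OF _ _ tendsto_const l[simplified]])
    show "\<forall>\<^sub>F n in sequentially. 0 \<le> top_sum (\<lambda>j. y j + z j) n / \<phi> n"
      using phi_pos top_sum_nonneg by (auto simp: eventually_sequentially less_imp_le intro!: exI[of _ 1] divide_nonneg_pos)
    show "\<forall>\<^sub>F n in sequentially. top_sum (\<lambda>j. y j + z j) n / \<phi> n \<le> top_sum y n / \<phi> n + top_sum z n / \<phi> n"
      using phi_pos top_sum_add[OF v]
      by (auto simp: eventually_sequentially less_imp_le divide_right_mono simp flip: add_divide_distrib intro!: exI[of _ 1])
  qed
  then show ?thesis using assms vanishing_add[OF v] by (simp add: marc0_iff)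
qed

lemma marc0_cmult:
  assumes "y \<in> V"
  shows "(\<lambda>j. c * y j) \<in> V"
proof -
  have v: "vanishing y" using assms vanishing_marc0 by auto
  have l: "(\<lambda>n. \<bar>c\<bar> * (top_sum y n / \<phi> n)) \<longlonglongrightarrow> \<bar>c\<bar> * 0"
    using assms by (intro tendsto_mult tendsto_const) (auto simp: marc0_iff)
  have "(\<lambda>n. top_sum (\<lambda>j. c * y j) n / \<phi> n) \<longlonglongrightarrow> 0"
  proof (rule tendsto_sandwich[OF _ _ tendsto_const l[simplified]])
    show "\<forall>\<^sub>F n in sequentially. 0 \<le> top_sum (\<lambda>j. c * y j) n / \<phi> n"
      using phi_pos top_sum_nonneg by (auto simp: eventually_sequentially less_imp_le intro!: exI[of _ 1] divide_nonneg_pos)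
    show "\<forall>\<^sub>F n in sequentially. top_sum (\<lambda>j. c * y j) n / \<phi> n \<le> \<bar>c\<bar> * top_sum y n / \<phi> n"
      using phi_pos top_sum_cmult_le[OF v]
      by (auto simp: eventually_sequentially less_imp_le divide_right_mono intro!: exI[of _ 1])
  qed
  then show ?thesis using assms vanishing_cmult[OF v] by (simp add: marc0_iff)
qed

lemma norm_cmult_le:
  assumes "y \<in> V"
  shows "N (\<lambda>j. c * y j) \<le> \<bar>c\<bar> * N y"
proof (rule norm_le[OF marc0_cmult[OF assms]])
  fix n :: nat
  have "top_sum (\<lambda>j. c * y j) n \<le> \<bar>c\<bar> * top_sum y n"
    by (rule top_sum_cmult_le[OF vanishing_marc0[OF assms]])
  also have "\<dots> \<le> \<bar>c\<bar> * (\<phi> n * N y)" by (intro mult_left_mono top_sum_le_norm[OF assms]) simp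
  finally show "top_sum (\<lambda>j. c * y j) n \<le> \<phi> n * (\<bar>c\<bar> * N y)" by (simp add: mult.left_commute)
qed

lemma dual_norm_bound:
  assumes f: "f \<in> dual V N" and y: "y \<in> V"
  shows "\<bar>f y\<bar> \<le> dual_norm V N f * N y"
proof -
  obtain C where C: "\<And>y. y \<in> V \<Longrightarrow> \<bar>f y\<bar> \<le> C * N y"
    using f unfolding dual_def by blast
  have hom: "f (\<lambda>j. c * y j) = c * f y" for c using f y by (auto simp: dual_def)
  show ?thesis
  proof (cases "N y = 0")
    case True
    then show ?thesis using C[OF y] by simp
  next
    case False
    then have Ny: "N y > 0" using norm_nonneg[of y] by simp
    define z where "z = (\<lambda>j. inverse (N y) * y j)"
    have z: "z \<in> V" "N z \<le> 1"
      using marc0_cmult[OF y] norm_cmult_le[OF y, of "inverse (N y)"] Ny by (simp_all add: z_def)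
    have "\<bar>f z\<bar> \<le> dual_norm V N f"
      unfolding dual_norm_def
    proof (rule cSUP_upper)
      show "bdd_above ((\<lambda>y. \<bar>f y\<bar>) ` {y \<in> V. N y \<le> 1})"
      proof (rule bdd_aboveI2)
        fix v assume v: "v \<in> {y \<in> V. N y \<le> 1}"
        then have "\<bar>f v\<bar> \<le> C * N v" using C by simp
        also have "\<dots> \<le> \<bar>C\<bar> * 1" using v norm_nonneg[of v] by (intro mult_mono) auto
        finally show "\<bar>f v\<bar> \<le> \<bar>C\<bar> * 1" .
      qed
    qed (use z in simp)
    moreover have "f z = inverse (N y) * f y" by (simp add: z_def hom)
    ultimately show ?thesis using Ny by (simp add: abs_mult field_simps)
  qed
qed

text \<open>
  The functionals whose supremum is the norm.  The name refers to the intended \<open>s\<close> with values in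
  \<open>{-1, 0, 1}\<close>; the estimates hold for all coefficients of modulus at most one.
\<close>

definition sign_functional :: "nat set \<Rightarrow> (nat \<Rightarrow> real) \<Rightarrow> (nat \<Rightarrow> real) \<Rightarrow> real" where
  "sign_functional A s = (\<lambda>y\<in>V. (\<Sum>j\<in>A. s j * y j) / \<phi> (card A))"

lemma sign_functional_le:
  assumes A: "A \<subseteq> {1..}" "finite A" "A \<noteq> {}" and s: "\<And>j. \<bar>s j\<bar> \<le> 1" and y: "y \<in> V"
  shows "\<bar>sign_functional A s y\<bar> \<le> N y"
proof -
  have pos: "\<phi> (card A) > 0" using A by (intro phi_pos) (simp add: Suc_le_eq card_gt_0_iff)
  have "\<bar>\<Sum>j\<in>A. s j * y j\<bar> \<le> (\<Sum>j\<in>A. \<bar>y j\<bar>)"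
    using s by (intro sum_norm_le[where 'a=real, simplified]) (auto simp: abs_mult mult_left_le_one_le)
  also have "\<dots> \<le> top_sum y (card A)" by (intro sum_le_top_sum vanishing_marc0 y A)
  also have "\<dots> \<le> \<phi> (card A) * N y" by (rule top_sum_le_norm[OF y])
  finally show ?thesis using pos y by (simp add: sign_functional_def field_simps)
qed

lemma sign_functional_dual:
  assumes A: "A \<subseteq> {1..}" "finite A" "A \<noteq> {}" and s: "\<And>j. \<bar>s j\<bar> \<le> 1"
  shows "sign_functional A s \<in> dual V N"
  unfolding dual_def
proof (intro CollectI conjI ballI allI exI[of _ 1])
  show "sign_functional A s \<in> extensional V" by (simp add: sign_functional_def)
next
  fix y z assume "y \<in> V" "z \<in> V"
  then show "sign_functional A s (\<lambda>k. y k + z k) = sign_functional A s y + sign_functional A s z"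
    by (simp add: sign_functional_def marc0_add distrib_left sum.distrib add_divide_distrib)
next
  fix c y assume "y \<in> V"
  then show "sign_functional A s (\<lambda>k. c * y k) = c * sign_functional A s y"
    by (simp add: sign_functional_def marc0_cmult sum_distrib_left mult.left_commute)
next
  fix y assume "y \<in> V"
  then show "\<bar>sign_functional A s y\<bar> \<le> 1 * N y"
    using sign_functional_le[OF assms] by simp
qed

lemma sign_functional_sphere:
  assumes A: "A \<subseteq> {1..}" "finite A" "A \<noteq> {}" and s: "\<And>j. \<bar>s j\<bar> \<le> 1"
    and x: "x \<in> V" "N x = 1" "sign_functional A s x = 1"
  shows "sign_functional A s \<in> unit_sphere (dual V N) (dual_norm V N)"
proof -
  have d: "sign_functional A s \<in> dual V N" by (rule sign_functional_dual[OF A s])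
  have "dual_norm V N (sign_functional A s) \<le> 1"
    unfolding dual_norm_def
  proof (rule cSUP_least)
    show "\<bar>sign_functional A s y\<bar> \<le> 1" if "y \<in> {y \<in> V. N y \<le> 1}" for y
      using that sign_functional_le[where s = s, OF A s, of y] by simp
  qed (use x in auto)
  moreover have "1 \<le> dual_norm V N (sign_functional A s)"
    using dual_norm_bound[OF d x(1)] x by simp
  ultimately show ?thesis using d by (simp add: unit_sphere_def)
qed

text \<open>The norm is attained at some cardinality, because the quotients tend to zero.\<close>

lemma sphere_norming_nonempty:
  assumes x: "x \<in> V" "N x = 1"
  shows "\<exists>n\<ge>1. top_sum x n = \<phi> n"
proof (rule ccontr)
  assume no: "\<not> ?thesis"
  have lt: "top_sum x n / \<phi> n < 1" if "n \<in> {1..}" for n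
    using no that top_sum_le_norm[OF x(1), of n] x(2) phi_pos[of n] by (force simp: field_simps)
  have lim: "(\<lambda>n. top_sum x n / \<phi> n) \<longlonglongrightarrow> 0" using x by (simp add: marc0_iff)
  obtain c where c: "c < 1" "\<And>n. n \<in> {1..} \<Longrightarrow> top_sum x n / \<phi> n \<le> c"
    using uniform_bound_of_tendsto_0[OF lim lt] by blast
  have "N x \<le> c"
    using c(2) phi_pos by (intro norm_le[OF x(1)]) (simp add: field_simps)
  then show False using c x by simp
qed

text \<open>
  Unit vectors lie in the space only if \<open>\<phi>\<close> is unbounded; otherwise the space is trivial.  A point
  \<open>x\<close> of norm one excludes the trivial case: since \<open>top_sum x m \<ge> x\<^sup>*(1) > 0\<close> for positive \<open>m\<close>, the
  quotients of the unit vector are dominated by a multiple of those of \<open>x\<close>.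
\<close>

lemma unit_vector_marc0:
  assumes x: "x \<in> V" "N x = 1" and j: "j \<ge> 1"
  shows "(\<lambda>i. if i = j then 1 else 0) \<in> V"
proof -
  let ?e = "\<lambda>i. if i = j then 1 else 0 :: real"
  obtain k where k: "decr_enum x k" using vanishing_decr_enum[OF vanishing_marc0[OF x(1)]] .
  obtain n where n: "n \<ge> 1" "top_sum x n = \<phi> n" using sphere_norming_nonempty[OF x] by blast
  have b: "\<bar>x (k 0)\<bar> > 0"
  proof (rule ccontr)
    assume "\<not> ?thesis"
    then have "x (k i) = 0" for i using decr_enum_antimono[OF k, of 0 i] by simp
    then have "top_sum x n = 0" by (simp add: top_sum_decr_enum(1)[OF k])
    then show False using n phi_pos[of n] by simp
  qed
  have v: "vanishing ?e"
    unfolding vanishing_def by (auto intro!: finite_subset[of _ "{j}"] split: if_splits)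
  have e_le: "top_sum ?e m \<le> 1" for m
  proof -
    obtain B where "finite B" "top_sum ?e m = (\<Sum>i\<in>B. \<bar>?e i\<bar>)"
      using top_sum_attained[OF v] by metis
    moreover have "(\<Sum>i\<in>B. \<bar>?e i\<bar>) = (\<Sum>i\<in>B. ?e i)" by (intro sum.cong) auto
    ultimately show ?thesis by simp
  qed
  have l: "(\<lambda>m. inverse \<bar>x (k 0)\<bar> * (top_sum x m / \<phi> m)) \<longlonglongrightarrow> inverse \<bar>x (k 0)\<bar> * 0"
    using x by (intro tendsto_mult tendsto_const) (simp add: marc0_iff)
  have "(\<lambda>m. top_sum ?e m / \<phi> m) \<longlonglongrightarrow> 0"
  proof (rule tendsto_sandwich[OF _ _ tendsto_const l[simplified mult_zero_right]])
    show "\<forall>\<^sub>F m in sequentially. 0 \<le> top_sum ?e m / \<phi> m"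
      using phi_pos top_sum_nonneg by (auto simp: eventually_sequentially less_imp_le intro!: exI[of _ 1] divide_nonneg_pos)
    have "top_sum ?e m / \<phi> m \<le> inverse \<bar>x (k 0)\<bar> * (top_sum x m / \<phi> m)" if m: "m \<ge> 1" for m
    proof -
      have "\<bar>x (k 0)\<bar> \<le> top_sum x m"
        using m unfolding top_sum_decr_enum(1)[OF k] by (intro member_le_sum) auto
      then have "1 \<le> inverse \<bar>x (k 0)\<bar> * top_sum x m" using b by (simp add: field_simps)
      then have "top_sum ?e m \<le> inverse \<bar>x (k 0)\<bar> * top_sum x m" using e_le[of m] by linarith
      then show ?thesis using phi_pos[OF m] by (simp add: divide_right_mono)
    qed
    then show "\<forall>\<^sub>F m in sequentially. top_sum ?e m / \<phi> m \<le> inverse \<bar>x (k 0)\<bar> * (top_sum x m / \<phi> m)"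
      by (auto simp: eventually_sequentially)
  qed
  then show ?thesis using v j by (simp add: marc0_iff)
qed

section \<open>Smooth points\<close>

text \<open>
  Each norming cardinality yields a norming functional, and smoothness identifies any two of these.
  The support of such a functional can be read off from its values at unit vectors, so the
  cardinality is determined.
\<close>

lemma smooth_point_norming_unique:
  assumes x: "x \<in> V" "N x = 1" and smooth: "smooth_point V N x"
    and n: "n \<ge> 1" "top_sum x n = \<phi> n" and m: "m \<ge> 1" "top_sum x m = \<phi> m"
  shows "n = m"
proof -
  \<comment> \<open>The value at zeros of \<open>x\<close> is nonzero, so that the support of the functional is all of \<open>A\<close>.\<close>
  define s where "s j = (if x j < 0 then -1 else 1 :: real)" for j
  have s: "\<bar>s j\<bar> \<le> 1" "s j * x j = \<bar>x j\<bar>" "s j \<noteq> 0" for j by (auto simp: s_def)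
  have v: "vanishing x" by (rule vanishing_marc0[OF x(1)])
  have ex: "\<exists>A. A \<subseteq> {1..} \<and> finite A \<and> card A = p \<and>
      sign_functional A s \<in> unit_sphere (dual V N) (dual_norm V N) \<and> sign_functional A s x = N x"
    if p: "p \<ge> 1" "top_sum x p = \<phi> p" for p
  proof -
    obtain A where A: "A \<subseteq> {1..}" "finite A" "card A = p" "top_sum x p = (\<Sum>j\<in>A. \<bar>x j\<bar>)"
      using top_sum_attained[OF v] .
    have 1: "sign_functional A s x = 1"
      using A p x phi_pos[of p] by (simp add: sign_functional_def s)
    moreover have "A \<noteq> {}" using A p by auto
    ultimately show ?thesis using sign_functional_sphere[OF A(1,2) _ s(1) x] A x by auto
  qed
  obtain A where A: "A \<subseteq> {1..}" "finite A" "card A = n"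
      "sign_functional A s \<in> unit_sphere (dual V N) (dual_norm V N)" "sign_functional A s x = N x"
    using ex[OF n] by blast
  obtain B where B: "B \<subseteq> {1..}" "finite B" "card B = m"
      "sign_functional B s \<in> unit_sphere (dual V N) (dual_norm V N)" "sign_functional B s x = N x"
    using ex[OF m] by blast
  have eq: "sign_functional A s = sign_functional B s"
    using smooth A B unfolding smooth_point_def by blast
  have val: "sign_functional C s (\<lambda>i. if i = j then 1 else 0) \<noteq> 0 \<longleftrightarrow> j \<in> C"
    if "C \<subseteq> {1..}" "finite C" "card C \<ge> 1" "j \<ge> 1" for C j
    using that phi_pos[of "card C"] unit_vector_marc0[OF x that(4)] s(3)[of j]
    by (simp add: sign_functional_def if_distrib sum.delta cong: if_cong)
  have "j \<in> A \<longleftrightarrow> j \<in> B" for j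
  proof (cases "j \<ge> 1")
    case True
    then show ?thesis using val[of A j] val[of B j] eq A B n m by simp
  next
    case False
    then show ?thesis using A(1) B(1) by auto
  qed
  then have "A = B" by blast
  then show ?thesis using A B by simp
qed

text \<open>
  The norm coincides along every line near \<open>x\<close> with the linear function \<open>f0\<close>, so it has a Gateaux
  derivative at \<open>x\<close>, which every norming functional must equal.
\<close>

lemma smooth_point_of_norming_unique:
  assumes x: "x \<in> V" "N x = 1"
    and n: "n \<ge> 1" "top_sum x n = \<phi> n"
    and uniq: "\<And>m. m \<ge> 1 \<Longrightarrow> top_sum x m = \<phi> m \<Longrightarrow> m = n"
  shows "smooth_point V N x"
proof -
  have v: "vanishing x" by (rule vanishing_marc0[OF x(1)])
  obtain k where k: "decr_enum x k" using vanishing_decr_enum[OF v] .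
  obtain p where p: "n = Suc p" using n by (cases n) auto
  have le: "top_sum x m \<le> \<phi> m" for m using top_sum_le_norm[OF x(1), of m] x by simp
  have lt: "top_sum x m < \<phi> m" if "m \<ge> 1" "m \<noteq> n" for m
    using le[of m] uniq[of m] that by linarith
  define gap where "gap = \<bar>x (k p)\<bar> - \<bar>x (k n)\<bar>"
  \<comment> \<open>\<open>top_sum x\<close> touches the concave majorant \<open>\<phi>\<close> at \<open>n\<close> and not at \<open>Suc n\<close>, so its slope drops strictly there.\<close>
  have gap: "gap > 0"
    using le[of p] lt[of "Suc n"] n top_sum_Suc[OF k, of p] top_sum_Suc[OF k, of n] phi_concave[of p]
    by (simp add: gap_def p)
  define A where "A = k ` {..<n}"
  have A: "A \<subseteq> {1..}" "finite A" "card A = n" "A \<noteq> {}" "(\<Sum>j\<in>A. \<bar>x j\<bar>) = \<phi> n"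
    using k n sum_decr_enum_image[OF k, of n] by (auto simp: A_def decr_enum_def)
  have x_nz: "x j \<noteq> 0" if j: "j \<in> A" for j
  proof -
    obtain i where "i \<le> p" "j = k i" using j by (auto simp: A_def p less_Suc_eq_le)
    then show ?thesis using decr_enum_antimono[OF k, of i p] gap by (auto simp: gap_def)
  qed
  define f0 where "f0 = sign_functional A (\<lambda>j. sgn (x j))"
  have sg: "\<bar>sgn (x j)\<bar> \<le> 1" for j by (simp add: sgn_real_def)
  have f0_eq: "f0 y = (\<Sum>j\<in>A. sgn (x j) * y j) / \<phi> n" if "y \<in> V" for y
    using that A by (simp add: f0_def sign_functional_def)
  have f0_le: "\<bar>f0 y\<bar> \<le> N y" if "y \<in> V" for y
    unfolding f0_def by (rule sign_functional_le[OF A(1,2,4) sg that])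
  have f0_x: "f0 x = 1" using A(5) phi_pos[OF n(1)] by (simp add: f0_eq x abs_sgn mult.commute)
  have f0: "f0 \<in> unit_sphere (dual V N) (dual_norm V N)"
    unfolding f0_def by (rule sign_functional_sphere[OF A(1,2,4) sg x f0_x[unfolded f0_def]])
  have f0_dual: "f0 \<in> dual V N" using f0 by (simp add: unit_sphere_def)
  have "\<exists>\<eta>>0. \<forall>B\<subseteq>{1..}. finite B \<longrightarrow> B \<noteq> {} \<longrightarrow> B \<noteq> A \<longrightarrow>
          (\<Sum>j\<in>B. \<bar>x j\<bar>) \<le> (1 - \<eta>) * \<phi> (card B)"
  proof -
    have lim: "(\<lambda>m. top_sum x m / \<phi> m) \<longlonglongrightarrow> 0" using x by (simp add: marc0_iff)
    have lt1: "top_sum x m / \<phi> m < 1" if "m \<in> {1..} - {n}" for m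
      using that lt[of m] phi_pos[of m] by simp
    obtain c where c: "c < 1" "\<And>m. m \<in> {1..} - {n} \<Longrightarrow> top_sum x m / \<phi> m \<le> c"
      using uniform_bound_of_tendsto_0[OF lim lt1] by blast
    \<comment> \<open>The first term serves sets of a size other than \<open>n\<close>, the second one the sets of size \<open>n\<close> other than \<open>A\<close>.\<close>
    define \<eta> where "\<eta> = min (1 - c) (gap / \<phi> n)"
    have "\<eta> > 0" using c gap phi_pos[OF n(1)] by (simp add: \<eta>_def)
    moreover have "(\<Sum>j\<in>B. \<bar>x j\<bar>) \<le> (1 - \<eta>) * \<phi> (card B)"
      if B: "B \<subseteq> {1..}" "finite B" "B \<noteq> {}" "B \<noteq> A" for B
    proof -
      have B1: "card B \<ge> 1" using B by (simp add: Suc_le_eq card_gt_0_iff)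
      note pos = phi_pos[OF B1]
      show ?thesis
      proof (cases "card B = n")
        case True
        have "(\<Sum>j\<in>B. \<bar>x j\<bar>) \<le> \<phi> n - gap"
          using sum_le_top_sum_gap[OF k B(1,2), of p] True B(4) n(2)
          by (simp add: A_def p gap_def)
        moreover have "\<eta> * \<phi> n \<le> gap / \<phi> n * \<phi> n"
          using pos True by (intro mult_right_mono) (simp_all add: \<eta>_def)
        ultimately show ?thesis using pos True by (simp add: algebra_simps)
      next
        case False
        have "(\<Sum>j\<in>B. \<bar>x j\<bar>) \<le> top_sum x (card B)" by (rule sum_le_top_sum[OF v B(1,2)])
        also have "\<dots> \<le> c * \<phi> (card B)" using c(2)[of "card B"] False B1 pos by (simp add: field_simps)
        also have "\<dots> \<le> (1 - \<eta>) * \<phi> (card B)" using pos by (intro mult_right_mono) (simp_all add: \<eta>_def)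
        finally show ?thesis .
      qed
    qed
    ultimately show ?thesis by blast
  qed
  then obtain \<eta> where eta: "\<eta> > 0" and gapB: "\<And>B. B \<subseteq> {1..} \<Longrightarrow> finite B \<Longrightarrow> B \<noteq> {} \<Longrightarrow> B \<noteq> A \<Longrightarrow>
          (\<Sum>j\<in>B. \<bar>x j\<bar>) \<le> (1 - \<eta>) * \<phi> (card B)"
    by blast
  have near: "\<forall>\<^sub>F t in nhds 0. N (\<lambda>j. x j + t * y j) \<le> 1 + t * f0 y" if y: "y \<in> V" for y
  proof -
    \<comment> \<open>Two smallness conditions: no entry on \<open>A\<close> changes sign, and no other set catches up with \<open>A\<close>.\<close>
    have "\<forall>\<^sub>F t in nhds 0. \<forall>j\<in>A. \<bar>t * y j\<bar> < \<bar>x j\<bar>"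
    proof (intro eventually_ball_finite A ballI)
      fix j assume "j \<in> A"
      have "((\<lambda>t. \<bar>t * y j\<bar>) \<longlongrightarrow> \<bar>0 * y j\<bar>) (nhds 0)" by (intro tendsto_intros) (simp add: filterlim_ident)
      then show "\<forall>\<^sub>F t in nhds 0. \<bar>t * y j\<bar> < \<bar>x j\<bar>"
        by (rule order_tendstoD) (simp add: x_nz \<open>j \<in> A\<close>)
    qed
    moreover have "\<forall>\<^sub>F t in nhds 0. 2 * \<bar>t\<bar> * N y < \<eta>"
    proof -
      have "((\<lambda>t. 2 * \<bar>t\<bar> * N y) \<longlongrightarrow> 2 * \<bar>0\<bar> * N y) (nhds 0)" by (intro tendsto_intros) (simp add: filterlim_ident)
      then show ?thesis by (rule order_tendstoD) (simp add: eta)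
    qed
    ultimately show ?thesis
    proof eventually_elim
      case (elim t)
      let ?z = "\<lambda>j. x j + t * y j"
      have z: "?z \<in> V" by (intro marc0_add marc0_cmult x y)
      have f0z: "f0 ?z = 1 + t * f0 y"
        using f0_dual x(1) y marc0_cmult[OF y] f0_x by (simp add: dual_def)
      have "top_sum ?z m \<le> \<phi> m * f0 ?z" if m: "m \<ge> 1" for m
      proof -
        obtain B where B: "B \<subseteq> {1..}" "finite B" "card B = m" "top_sum ?z m = (\<Sum>j\<in>B. \<bar>?z j\<bar>)"
          using top_sum_attained[OF vanishing_marc0[OF z]] .
        show ?thesis
        proof (cases "B = A")
          case True
          have "\<bar>?z j\<bar> = sgn (x j) * ?z j" if "j \<in> A" for j
            using elim(1) that by (intro abs_add_eq_sgn_mult) blast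
          then have "top_sum ?z m = (\<Sum>j\<in>A. sgn (x j) * ?z j)" using B True by simp
          then show ?thesis using f0_eq[OF z] True A B phi_pos[OF m] by simp
        next
          case False
          have "top_sum ?z m \<le> (\<Sum>j\<in>B. \<bar>x j\<bar> + \<bar>t\<bar> * \<bar>y j\<bar>)"
            unfolding B(4) by (intro sum_mono) (metis abs_mult abs_triangle_ineq)
          also have "\<dots> = (\<Sum>j\<in>B. \<bar>x j\<bar>) + \<bar>t\<bar> * (\<Sum>j\<in>B. \<bar>y j\<bar>)"
            by (simp add: sum.distrib sum_distrib_left)
          also have "\<dots> \<le> (1 - \<eta>) * \<phi> m + \<bar>t\<bar> * (\<phi> m * N y)"
          proof (intro add_mono mult_left_mono)
            show "(\<Sum>j\<in>B. \<bar>x j\<bar>) \<le> (1 - \<eta>) * \<phi> m" using gapB[OF B(1,2) _ False] B(3) m by force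
            show "(\<Sum>j\<in>B. \<bar>y j\<bar>) \<le> \<phi> m * N y"
              using sum_le_top_sum[OF vanishing_marc0[OF y] B(1,2)] top_sum_le_norm[OF y, of m] B by simp
          qed simp
          also have "\<dots> = \<phi> m * (1 - \<eta> + \<bar>t\<bar> * N y)" by (simp add: algebra_simps)
          also have "\<dots> \<le> \<phi> m * f0 ?z"
          proof (rule mult_left_mono)
            have "\<bar>t * f0 y\<bar> \<le> \<bar>t\<bar> * N y" using f0_le[OF y] by (simp add: abs_mult mult_left_mono)
            then show "1 - \<eta> + \<bar>t\<bar> * N y \<le> f0 ?z" unfolding f0z using elim(2) by linarith
          qed (use phi_pos[OF m] in simp)
          finally show ?thesis .
        qed
      qed
      then have "N ?z \<le> f0 ?z" by (rule norm_le[OF z])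
      then show ?case by (simp add: f0z)
    qed
  qed
  have "f = f0" if f: "f \<in> unit_sphere (dual V N) (dual_norm V N)" "f x = N x" for f
  proof (rule extensionalityI[of _ V])
    show "f \<in> extensional V" "f0 \<in> extensional V" using f f0 by (auto simp: unit_sphere_def dual_def)
    fix y assume y: "y \<in> V"
    have "\<forall>\<^sub>F t in nhds 0. t * f y \<le> t * f0 y"
      using near[OF y]
    proof eventually_elim
      case (elim t)
      let ?z = "\<lambda>j. x j + t * y j"
      have fd: "f \<in> dual V N" "dual_norm V N f = 1" using f by (auto simp: unit_sphere_def)
      have z: "?z \<in> V" by (intro marc0_add marc0_cmult x y)
      have "f ?z = 1 + t * f y"
        using fd x y marc0_cmult[OF y] f(2) by (simp add: dual_def)
      then show ?case using dual_norm_bound[OF fd(1) z] fd(2) elim by simp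
    qed
    then obtain d where d: "d > 0" "\<And>t. \<bar>t\<bar> < d \<Longrightarrow> t * f y \<le> t * f0 y"
      by (auto simp: eventually_nhds_metric dist_real_def)
    \<comment> \<open>Arguments of both signs give both inequalities between \<open>f y\<close> and \<open>f0 y\<close>.\<close>
    then show "f y = f0 y" using d(2)[of "d/2"] d(2)[of "-(d/2)"] by simp
  qed
  then show ?thesis unfolding smooth_point_def using x f0 f0_x by auto
qed

theorem smooth_point_iff:
  assumes "x \<in> unit_sphere V N"
  shows "smooth_point V N x \<longleftrightarrow> card {n. n \<ge> 1 \<and> mrearr x n * ennreal (\<psi> n) = 1} = 1"
proof -
  have x: "x \<in> V" "N x = 1" using assms by (auto simp: unit_sphere_def)
  have "mrearr x n * ennreal (\<psi> n) = 1 \<longleftrightarrow> top_sum x n = \<phi> n" if "n \<ge> 1" for n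
    using mrearr_psi[OF vanishing_marc0[OF x(1)] that] phi_pos[OF that] by auto
  then have M: "{n. n \<ge> 1 \<and> mrearr x n * ennreal (\<psi> n) = 1} = {n. n \<ge> 1 \<and> top_sum x n = \<phi> n}"
    by blast
  show ?thesis unfolding M
  proof
    assume "smooth_point V N x"
    moreover obtain n where "n \<ge> 1" "top_sum x n = \<phi> n" using sphere_norming_nonempty[OF x] by blast
    ultimately have "{n. n \<ge> 1 \<and> top_sum x n = \<phi> n} = {n}"
      using smooth_point_norming_unique[OF x] by blast
    then show "card {n. n \<ge> 1 \<and> top_sum x n = \<phi> n} = 1" by simp
  next
    assume "card {n. n \<ge> 1 \<and> top_sum x n = \<phi> n} = 1"
    then obtain n where n: "{n. n \<ge> 1 \<and> top_sum x n = \<phi> n} = {n}" by (auto simp: card_1_singleton_iff)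
    show "smooth_point V N x"
      by (rule smooth_point_of_norming_unique[OF x, of n]) (use n in blast)+
  qed
qed

end

section \<open>The fundamental sequence of the Lorentz space\<close>

text \<open>
  The increment of \<open>W + W\<^sub>1\<close> at \<open>n\<close> is the tail \<open>T n\<close> of the series of \<open>w i / i\<close> over \<open>i > n\<close>: in \<open>n T n\<close>, moving the
  term \<open>w (n + 1) / (n + 1)\<close> out of the tail costs \<open>n w (n + 1) / (n + 1)\<close>, which the gain \<open>w (n + 1)\<close> in \<open>W\<close>
  more than compensates.  Tails of a nonnegative series decrease, which is concavity.
\<close>

lemma concave_fundamental_lorentz:
  assumes w: "weight_seq w" and psi: "\<forall>n\<ge>1. \<psi> n = real n / lorentz_fundamental w n"
  shows "concave_fundamental (\<lambda>n. partial_weight w n + tail_weight w n) \<psi>"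
proof -
  define T where "T n = (\<Sum>i. w (n + 1 + i) / real (n + 1 + i))" for n
  have nn: "w (n + 1 + i) / real (n + 1 + i) \<ge> 0" for n i using w by (simp add: weight_seq_def)
  have sm: "summable (\<lambda>i. w (n + 1 + i) / real (n + 1 + i))" for n
  proof (cases "n \<ge> 1")
    case True
    then show ?thesis using w by (simp add: weight_seq_def)
  next
    case False
    have "summable (\<lambda>i. w (1 + 1 + i) / real (1 + 1 + i))" using w by (simp only: weight_seq_def)
    moreover have "n = 0" using False by simp
    ultimately show ?thesis using summable_Suc_iff[of "\<lambda>i. w (0 + 1 + i) / real (0 + 1 + i)"] by simp
  qed
  have T_nn: "T n \<ge> 0" for n unfolding T_def by (intro suminf_nonneg sm nn)
  have T_Suc: "T n = w (Suc n) / real (Suc n) + T (Suc n)" for n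
    using suminf_split_head[OF sm[of n]] by (simp add: T_def)
  have tail: "tail_weight w n = real n * T n" for n by (simp add: tail_weight_def T_def)
  have inc: "partial_weight w (Suc n) + tail_weight w (Suc n) - (partial_weight w n + tail_weight w n) = T n" for n
    unfolding tail T_Suc[of n] by (simp add: partial_weight_def field_simps)
  show ?thesis
  proof
    show "partial_weight w 0 + tail_weight w 0 = 0" by (simp add: tail partial_weight_def)
    show "partial_weight w (Suc (Suc n)) + tail_weight w (Suc (Suc n)) - (partial_weight w (Suc n) + tail_weight w (Suc n))
        \<le> partial_weight w (Suc n) + tail_weight w (Suc n) - (partial_weight w n + tail_weight w n)" for n
      unfolding inc using T_Suc[of n] w by (simp add: weight_seq_def)
    show "\<psi> n = real n / (partial_weight w n + tail_weight w n)" if "n \<ge> 1" for n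
      using psi that lorentz_fundamental_eq[OF w that] by simp
    show "0 < partial_weight w n + tail_weight w n" if n: "n \<ge> 1" for n
    proof -
      obtain j where j: "j \<ge> 1" "w j > 0" using w by (auto simp: weight_seq_def)
      have p: "partial_weight w n \<ge> 0" using w by (auto simp: weight_seq_def partial_weight_def intro!: sum_nonneg)
      show ?thesis
      proof (cases "j \<le> n")
        case True
        have "w j \<le> partial_weight w n"
          unfolding partial_weight_def using True j w by (intro member_le_sum) (auto simp: weight_seq_def)
        moreover have "tail_weight w n \<ge> 0" using T_nn by (simp add: tail)
        ultimately show ?thesis using j by linarith
      next
        case False
        then have "w (n + 1 + (j - n - 1)) / real (n + 1 + (j - n - 1)) > 0" using j by simp
        then have "T n > 0" unfolding T_def using suminf_pos2[OF sm nn] by blast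
        then show ?thesis using p n by (simp add: tail add_nonneg_pos)
      qed
    qed
  qed
qed

theorem theorem6p4:
  fixes w \<psi> x :: "nat \<Rightarrow> real"
  assumes "weight_seq w"
    and "\<forall>n\<ge>1. \<psi> n = real n / lorentz_fundamental w n"
    and "x \<in> unit_sphere (marc0 \<psi>) (marc_norm \<psi>)"
  shows "smooth_point (marc0 \<psi>) (marc_norm \<psi>) x \<longleftrightarrow>
         card {n. n \<ge> 1 \<and> mrearr x n * ennreal (\<psi> n) = 1} = 1"
  using concave_fundamental.smooth_point_iff[OF concave_fundamental_lorentz[OF assms(1,2)] assms(3)] .

end
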